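(* In each of the following round-robin tournament models with $n$ players, the total scores $S_i=\sum_{j=1,\,j\ne i}^n X_{ij}$, $i=1,\ldots,n$, are negatively associated; consequently they are also NLOD, NUOD, and hence NOD. In all models the variables $X_{ij}$, $1\le i<j\le n$, are independent and $X_{ji}=r_{ij}-X_{ij}$ for $i<j$. (1) General constant-sum round-robin: $r_{ij}\ge 0$ and $X_{ij}$ ($i<j$) has a distribution function $F_{ij}$ with support on $[0,r_{ij}]$. (2) Integer rewards: $r_{ij}$ is a nonnegative integer and $F_{ij}$ has support $\{0,1,\ldots,r_{ij}\}$. (3) Pairwise repeated games: $X_{ij}\sim \mathrm{Binomial}(r_{ij},p_{ij})$ for $i<j$, where $r_{ij}$ is a nonnegative integer and $p_{ij}\in[0,1]$. (4) Simple round-robin: $r_{ij}=1$, $X_{ij}\in\{0,1\}$ and $P(X_{ij}=1)=p_{ij}$. (5) Chess round-robin with draws: $r_{ij}=1$ and $X_{ij}\in\{0,1/2,1\}$, with arbitrary values of $P(X_{ij}=1)$ and $P(X_{ij}=1/2)$.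
   Context: Throughout, increasing means nondecreasing. Random variables $S_1,\ldots,S_n$ are said to be negatively associated (NA) if for every pair of disjoint subsets $A_1, A_2$ of $\{1,\ldots,n\}$, $$\mathrm{Cov}\left(f_1(S_i, i\in A_1),\, f_2(S_j, j\in A_2)\right)\leq 0$$ whenever $f_1$ and $f_2$ are real-valued functions, increasing in all coordinates, for which the covariance exists. They are negatively lower orthant dependent (NLOD) if for all $s_1,\ldots,s_n\in\mathbb{R}$, $P(S_1\le s_1,\ldots,S_n\le s_n)\le P(S_1\le s_1)\cdots P(S_n\le s_n)$; negatively upper orthant dependent (NUOD) if for all $s_1,\ldots,s_n\in\mathbb{R}$, $P(S_1>s_1,\ldots,S_n>s_n)\le P(S_1>s_1)\cdots P(S_n>s_n)$; and negatively orthant dependent (NOD) if both hold. Here $X_{ij}$ is player $i$'s reward in the match (or matches) against player $j$. *)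

theory Defs
  imports "HOL-Probability.Probability"
begin

definition has_covariance :: "'a measure \<Rightarrow> ('a \<Rightarrow> real) \<Rightarrow> ('a \<Rightarrow> real) \<Rightarrow> bool" where
  "has_covariance M Y Z \<longleftrightarrow>
     integrable M Y \<and> integrable M Z \<and> integrable M (\<lambda>\<omega>. Y \<omega> * Z \<omega>)"

definition covariance :: "'a measure \<Rightarrow> ('a \<Rightarrow> real) \<Rightarrow> ('a \<Rightarrow> real) \<Rightarrow> real" where
  "covariance M Y Z =
     integral\<^sup>L M (\<lambda>\<omega>. (Y \<omega> - integral\<^sup>L M Y) * (Z \<omega> - integral\<^sup>L M Z))"

text \<open>A real-valued function of the coordinates indexed by \<open>A\<close> is a function on
  \<open>extensional A\<close>, the underlying set of the product space \<open>PiM A (\<lambda>_. borel)\<close>.\<close>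

definition increasing_in_coords :: "'i set \<Rightarrow> (('i \<Rightarrow> real) \<Rightarrow> real) \<Rightarrow> bool" where
  "increasing_in_coords A f \<longleftrightarrow>
     (\<forall>x\<in>extensional A. \<forall>i\<in>A. mono (\<lambda>t. f (x(i := t))))"

text \<open>The test functions are Borel: an increasing function of two or more variables need not be,
  and if it is not, measurability of \<open>f (S\<^sub>i, i \<in> A)\<close> depends on the choice of \<open>M\<close> and not
  just on the joint law of the \<open>S\<^sub>i\<close>.\<close>

definition negatively_associated :: "'a measure \<Rightarrow> 'i set \<Rightarrow> ('i \<Rightarrow> 'a \<Rightarrow> real) \<Rightarrow> bool" where
  "negatively_associated M I S \<longleftrightarrow>
     (\<forall>A\<^sub>1 A\<^sub>2 f\<^sub>1 f\<^sub>2.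
        A\<^sub>1 \<subseteq> I \<and> A\<^sub>2 \<subseteq> I \<and> A\<^sub>1 \<inter> A\<^sub>2 = {} \<and>
        f\<^sub>1 \<in> borel_measurable (PiM A\<^sub>1 (\<lambda>_. borel)) \<and> increasing_in_coords A\<^sub>1 f\<^sub>1 \<and>
        f\<^sub>2 \<in> borel_measurable (PiM A\<^sub>2 (\<lambda>_. borel)) \<and> increasing_in_coords A\<^sub>2 f\<^sub>2 \<and>
        has_covariance M (\<lambda>\<omega>. f\<^sub>1 (\<lambda>i\<in>A\<^sub>1. S i \<omega>)) (\<lambda>\<omega>. f\<^sub>2 (\<lambda>j\<in>A\<^sub>2. S j \<omega>))
        \<longrightarrow> covariance M (\<lambda>\<omega>. f\<^sub>1 (\<lambda>i\<in>A\<^sub>1. S i \<omega>)) (\<lambda>\<omega>. f\<^sub>2 (\<lambda>j\<in>A\<^sub>2. S j \<omega>)) \<le> 0)"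

definition NLOD :: "'a measure \<Rightarrow> 'i set \<Rightarrow> ('i \<Rightarrow> 'a \<Rightarrow> real) \<Rightarrow> bool" where
  "NLOD M I S \<longleftrightarrow>
     (\<forall>s :: 'i \<Rightarrow> real. measure M {\<omega>\<in>space M. \<forall>i\<in>I. S i \<omega> \<le> s i}
        \<le> (\<Prod>i\<in>I. measure M {\<omega>\<in>space M. S i \<omega> \<le> s i}))"

definition NUOD :: "'a measure \<Rightarrow> 'i set \<Rightarrow> ('i \<Rightarrow> 'a \<Rightarrow> real) \<Rightarrow> bool" where
  "NUOD M I S \<longleftrightarrow>
     (\<forall>s :: 'i \<Rightarrow> real. measure M {\<omega>\<in>space M. \<forall>i\<in>I. S i \<omega> > s i}
        \<le> (\<Prod>i\<in>I. measure M {\<omega>\<in>space M. S i \<omega> > s i}))"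

definition NOD :: "'a measure \<Rightarrow> 'i set \<Rightarrow> ('i \<Rightarrow> 'a \<Rightarrow> real) \<Rightarrow> bool" where
  "NOD M I S \<longleftrightarrow> NLOD M I S \<and> NUOD M I S"

definition pairs :: "nat \<Rightarrow> (nat \<times> nat) set" where
  "pairs n = {(i, j). 1 \<le> i \<and> i < j \<and> j \<le> n}"

definition score :: "nat \<Rightarrow> (nat \<Rightarrow> nat \<Rightarrow> 'a \<Rightarrow> real) \<Rightarrow> nat \<Rightarrow> 'a \<Rightarrow> real" where
  "score n X i \<omega> = (\<Sum>j\<in>{1..n} - {i}. X i j \<omega>)"

definition round_robin ::
  "'a measure \<Rightarrow> nat \<Rightarrow> (nat \<Rightarrow> nat \<Rightarrow> real) \<Rightarrow> (nat \<Rightarrow> nat \<Rightarrow> 'a \<Rightarrow> real) \<Rightarrow> bool" where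
  "round_robin M n r X \<longleftrightarrow>
     prob_space M \<and>
     prob_space.indep_vars M (\<lambda>_. borel) (\<lambda>(i, j). X i j) (pairs n) \<and>
     (\<forall>(i, j)\<in>pairs n. \<forall>\<omega>\<in>space M. X j i \<omega> = r i j - X i j \<omega>)"

text \<open>The support of a distribution function: its points of increase.\<close>

definition cdf_support :: "(real \<Rightarrow> real) \<Rightarrow> real set" where
  "cdf_support F = {x. \<forall>e>0. F (x - e) < F (x + e)}"

definition constant_sum_model ::
  "'a measure \<Rightarrow> nat \<Rightarrow> (nat \<Rightarrow> nat \<Rightarrow> real) \<Rightarrow> (nat \<Rightarrow> nat \<Rightarrow> real \<Rightarrow> real) \<Rightarrow>
     (nat \<Rightarrow> nat \<Rightarrow> 'a \<Rightarrow> real) \<Rightarrow> bool" where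
  "constant_sum_model M n r F X \<longleftrightarrow>
     round_robin M n r X \<and>
     (\<forall>(i, j)\<in>pairs n. r i j \<ge> 0 \<and> cdf (distr M borel (X i j)) = F i j \<and>
        cdf_support (F i j) \<subseteq> {0..r i j})"

text \<open>In the integer model, values in \<open>{0, \<dots>, m}\<close> may have probability \<open>0\<close>, so that
  binomial rewards with \<open>p \<in> {0, 1}\<close> are not excluded.\<close>

definition integer_model ::
  "'a measure \<Rightarrow> nat \<Rightarrow> (nat \<Rightarrow> nat \<Rightarrow> real) \<Rightarrow> (nat \<Rightarrow> nat \<Rightarrow> real \<Rightarrow> real) \<Rightarrow>
     (nat \<Rightarrow> nat \<Rightarrow> 'a \<Rightarrow> real) \<Rightarrow> bool" where
  "integer_model M n r F X \<longleftrightarrow>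
     round_robin M n r X \<and>
     (\<forall>(i, j)\<in>pairs n. \<exists>m::nat. r i j = real m \<and> cdf (distr M borel (X i j)) = F i j \<and>
        cdf_support (F i j) \<subseteq> real ` {0..m})"

definition repeated_games_model ::
  "'a measure \<Rightarrow> nat \<Rightarrow> (nat \<Rightarrow> nat \<Rightarrow> real) \<Rightarrow> (nat \<Rightarrow> nat \<Rightarrow> real) \<Rightarrow>
     (nat \<Rightarrow> nat \<Rightarrow> 'a \<Rightarrow> real) \<Rightarrow> bool" where
  "repeated_games_model M n r p X \<longleftrightarrow>
     round_robin M n r X \<and>
     (\<forall>(i, j)\<in>pairs n. \<exists>m::nat. r i j = real m \<and> p i j \<in> {0..1} \<and>
        distr M borel (X i j) = distr (measure_pmf (binomial_pmf m (p i j))) borel real)"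

definition simple_model ::
  "'a measure \<Rightarrow> nat \<Rightarrow> (nat \<Rightarrow> nat \<Rightarrow> real) \<Rightarrow> (nat \<Rightarrow> nat \<Rightarrow> real) \<Rightarrow>
     (nat \<Rightarrow> nat \<Rightarrow> 'a \<Rightarrow> real) \<Rightarrow> bool" where
  "simple_model M n r p X \<longleftrightarrow>
     round_robin M n r X \<and>
     (\<forall>(i, j)\<in>pairs n. r i j = 1 \<and> (AE \<omega> in M. X i j \<omega> \<in> {0, 1}) \<and>
        measure M {\<omega>\<in>space M. X i j \<omega> = 1} = p i j)"

definition chess_model ::
  "'a measure \<Rightarrow> nat \<Rightarrow> (nat \<Rightarrow> nat \<Rightarrow> real) \<Rightarrow>
     (nat \<Rightarrow> nat \<Rightarrow> 'a \<Rightarrow> real) \<Rightarrow> bool" where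
  "chess_model M n r X \<longleftrightarrow>
     round_robin M n r X \<and>
     (\<forall>(i, j)\<in>pairs n. r i j = 1 \<and> (AE \<omega> in M. X i j \<omega> \<in> {0, 1/2, 1}))"

end

theory Submission
  imports Defs
begin

text \<open>
  In each of the five models the rewards \<open>X i j\<close>, \<open>i < j\<close>, are independent and the two rewards
  of a match have a constant sum. Negative association comes from these two properties. For
  disjoint sets \<open>A\<close> and \<open>B\<close> of players, \<open>f(S\<^sub>i, i \<in> A)\<close> and \<open>g(S\<^sub>j, j \<in> B)\<close> are
  functions \<open>F\<close> and \<open>G\<close> of the independent rewards \<open>X i j\<close>. Raising one such reward raises
  \<open>S\<^sub>i\<close>, lowers \<open>S\<^sub>j\<close> by the same amount and changes no other score. If \<open>i\<close> and \<open>j\<close> lie on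
  different sides, then \<open>F\<close> and \<open>G\<close> move in opposite directions. If they do not, at least
  one of \<open>F\<close>, \<open>G\<close> does not depend on this reward: when both players are in \<open>A\<close>, the effect on
  \<open>F\<close> has no definite sign, but \<open>G\<close> is constant. This alternative is the relation
  \<open>opposed_at\<close>.

  A pair that is opposed at every coordinate satisfies \<open>E(F G) \<le> E F E G\<close>
  (\<open>product_integral_le_if_opposed\<close>): integrate over one coordinate at a time. In that coordinate
  \<open>F\<close> and \<open>G\<close> are oppositely ordered, so Chebyshev's inequality replaces the mean of the product
  by the product of the means, and taking means keeps monotonicity in the remaining coordinates,
  hence opposedness. Truncating the test functions, which keeps them increasing, reduces the
  problem to bounded functions, where all integrals exist.

  The orthant inequalities follow by induction on the set of players: the indicator of an upper
  orthant is increasing, so negative association lets one split off one player at a time. For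
  lower orthants the same argument applies to the negated indicators.
\<close>

section \<open>Covariances and truncation\<close>

lemma (in prob_space) covariance_eq:
  assumes "has_covariance M Y Z"
  shows "covariance M Y Z = expectation (\<lambda>\<omega>. Y \<omega> * Z \<omega>) - expectation Y * expectation Z"
proof -
  have "covariance M Y Z = expectation (\<lambda>\<omega>. Y \<omega> * Z \<omega> - expectation Z * Y \<omega>
      - expectation Y * Z \<omega> + expectation Y * expectation Z)"
    unfolding covariance_def by (simp add: algebra_simps)
  also have "\<dots> = expectation (\<lambda>\<omega>. Y \<omega> * Z \<omega>) - expectation Y * expectation Z"
    using assms by (simp add: has_covariance_def prob_space)
  finally show ?thesis .
qed

text \<open>
  Clipping both functions to \<open>[-k, k]\<close> does not increase absolute values, so dominated convergence
  applies to each of the three integrals as \<open>k\<close> grows.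
\<close>

lemma product_integral_le_by_truncation:
  fixes Y Z :: "'a \<Rightarrow> real"
  assumes Y: "integrable M Y" and Z: "integrable M Z"
    and YZ: "integrable M (\<lambda>\<omega>. Y \<omega> * Z \<omega>)"
    and trunc: "\<And>k::nat. (\<integral>\<omega>. max (- real k) (min (real k) (Y \<omega>)) * max (- real k) (min (real k) (Z \<omega>)) \<partial>M)
      \<le> (\<integral>\<omega>. max (- real k) (min (real k) (Y \<omega>)) \<partial>M) * (\<integral>\<omega>. max (- real k) (min (real k) (Z \<omega>)) \<partial>M)"
  shows "(\<integral>\<omega>. Y \<omega> * Z \<omega> \<partial>M) \<le> (\<integral>\<omega>. Y \<omega> \<partial>M) * (\<integral>\<omega>. Z \<omega> \<partial>M)"
proof -
  define T where "T k t = max (- real k) (min (real k) t)" for k :: nat and t :: real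
  have T_le: "\<bar>T k t\<bar> \<le> \<bar>t\<bar>" for k t
    by (auto simp: T_def)
  have T_lim: "(\<lambda>k. T k t) \<longlonglongrightarrow> t" for t
  proof (rule tendsto_eventually)
    obtain m :: nat where m: "\<bar>t\<bar> \<le> real m"
      using real_arch_simple by blast
    show "\<forall>\<^sub>F k in sequentially. T k t = t"
      unfolding eventually_sequentially
    proof (intro exI[of _ m] allI impI)
      fix k assume "m \<le> k"
      then have "\<bar>t\<bar> \<le> real k"
        using m by linarith
      then show "T k t = t"
        by (auto simp: T_def)
    qed
  qed
  have T_meas: "(\<lambda>\<omega>. T k (W \<omega>)) \<in> borel_measurable M" if "integrable M W" for W k
    using that unfolding T_def by measurable
  have lim: "(\<lambda>k. \<integral>\<omega>. T k (W \<omega>) \<partial>M) \<longlonglongrightarrow> (\<integral>\<omega>. W \<omega> \<partial>M)" if "integrable M W" for W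
    by (rule integral_dominated_convergence[where w = "\<lambda>\<omega>. \<bar>W \<omega>\<bar>"])
      (use that T_meas T_lim T_le in auto)
  have "(\<lambda>k. \<integral>\<omega>. T k (Y \<omega>) * T k (Z \<omega>) \<partial>M) \<longlonglongrightarrow> (\<integral>\<omega>. Y \<omega> * Z \<omega> \<partial>M)"
  proof (rule integral_dominated_convergence[where w = "\<lambda>\<omega>. \<bar>Y \<omega> * Z \<omega>\<bar>"])
    show "AE \<omega> in M. (\<lambda>k. T k (Y \<omega>) * T k (Z \<omega>)) \<longlonglongrightarrow> Y \<omega> * Z \<omega>"
      by (intro AE_I2 tendsto_mult T_lim)
    show "AE \<omega> in M. norm (T k (Y \<omega>) * T k (Z \<omega>)) \<le> \<bar>Y \<omega> * Z \<omega>\<bar>" for k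
      by (auto simp: abs_mult intro!: mult_mono T_le)
  qed (use YZ in \<open>auto intro!: borel_measurable_times T_meas Y Z\<close>)
  moreover have "(\<lambda>k. (\<integral>\<omega>. T k (Y \<omega>) \<partial>M) * (\<integral>\<omega>. T k (Z \<omega>) \<partial>M))
      \<longlonglongrightarrow> (\<integral>\<omega>. Y \<omega> \<partial>M) * (\<integral>\<omega>. Z \<omega> \<partial>M)"
    by (intro tendsto_mult lim Y Z)
  ultimately show ?thesis
    by (rule LIMSEQ_le) (use trunc in \<open>auto simp: T_def\<close>)
qed

section \<open>Chebyshev's inequality for oppositely ordered functions\<close>

lemma (in prob_space) integrable_bounded:
  fixes u :: "'a \<Rightarrow> real"
  assumes "u \<in> borel_measurable M" "\<And>x. x \<in> space M \<Longrightarrow> \<bar>u x\<bar> \<le> B"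
  shows "integrable M u"
  using assms by (intro integrable_const_bound[where B = B]) auto

text \<open>
  For an independent copy \<open>y\<close> of \<open>x\<close>, the mean of \<open>(u x - u y) * (v x - v y)\<close> is twice the
  covariance of \<open>u\<close> and \<open>v\<close>. Integrating over \<open>y\<close> and then over \<open>x\<close> computes it without a
  product measure.
\<close>

lemma (in prob_space) chebyshev_oppositely_ordered:
  fixes u v :: "'a \<Rightarrow> real"
  assumes u: "integrable M u" and v: "integrable M v"
    and uv: "integrable M (\<lambda>x. u x * v x)"
    and opp: "\<And>x y. x \<in> space M \<Longrightarrow> y \<in> space M \<Longrightarrow> (u x - u y) * (v x - v y) \<le> 0"
  shows "(\<integral>x. u x * v x \<partial>M) \<le> (\<integral>x. u x \<partial>M) * (\<integral>x. v x \<partial>M)"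
proof -
  let ?U = "\<integral>x. u x \<partial>M" and ?V = "\<integral>x. v x \<partial>M" and ?W = "\<integral>x. u x * v x \<partial>M"
  have nonpos: "(\<integral>x. h x \<partial>M) \<le> 0" if "\<And>x. x \<in> space M \<Longrightarrow> h x \<le> 0" for h :: "'a \<Rightarrow> real"
    using integral_nonneg_AE[of "\<lambda>x. - h x" M] that by simp
  have inner: "u x * v x - u x * ?V - v x * ?U + ?W \<le> 0" if "x \<in> space M" for x
  proof -
    have "(\<integral>y. (u x - u y) * (v x - v y) \<partial>M)
        = (\<integral>y. u x * v x - u x * v y - v x * u y + u y * v y \<partial>M)"
      by (simp add: algebra_simps)
    also have "\<dots> = u x * v x - u x * ?V - v x * ?U + ?W"
      using u v uv by (simp add: prob_space)
    finally show ?thesis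
      using nonpos[of "\<lambda>y. (u x - u y) * (v x - v y)"] opp[OF that] by simp
  qed
  have "(\<integral>x. u x * v x - u x * ?V - v x * ?U + ?W \<partial>M) \<le> 0"
    by (rule nonpos) (rule inner)
  moreover have "(\<integral>x. u x * v x - u x * ?V - v x * ?U + ?W \<partial>M)
      = ?W - ?U * ?V - ?V * ?U + ?W"
    using u v uv by (simp add: prob_space)
  ultimately show ?thesis
    by (simp add: algebra_simps)
qed

section \<open>Opposed functions of independent variables\<close>

text \<open>
  This is \<open>increasing_in_coords\<close> for one coordinate. Being decreasing is expressed through
  \<open>- F\<close>, so that facts about averages have to be shown in one direction only.
\<close>

definition increasing_at :: "'i set \<Rightarrow> 'i \<Rightarrow> (('i \<Rightarrow> real) \<Rightarrow> real) \<Rightarrow> bool" where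
  "increasing_at I p F \<longleftrightarrow> (\<forall>x\<in>extensional I. mono (\<lambda>t. F (x(p := t))))"

abbreviation decreasing_at :: "'i set \<Rightarrow> 'i \<Rightarrow> (('i \<Rightarrow> real) \<Rightarrow> real) \<Rightarrow> bool" where
  "decreasing_at I p F \<equiv> increasing_at I p (\<lambda>x. - F x)"

text \<open>
  The last two alternatives say that \<open>F\<close> or \<open>G\<close> does not depend on the coordinate. The condition
  fixes one direction for all values of the other coordinates: the weaker requirement that the
  slices at \<open>p\<close> be pointwise oppositely ordered, with a direction depending on the slice, would
  be lost when another coordinate is averaged out.
\<close>

definition opposed_at ::
  "'i set \<Rightarrow> 'i \<Rightarrow> (('i \<Rightarrow> real) \<Rightarrow> real) \<Rightarrow> (('i \<Rightarrow> real) \<Rightarrow> real) \<Rightarrow> bool" where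
  "opposed_at I p F G \<longleftrightarrow>
     increasing_at I p F \<and> decreasing_at I p G \<or> decreasing_at I p F \<and> increasing_at I p G \<or>
     increasing_at I p F \<and> decreasing_at I p F \<or> increasing_at I p G \<and> decreasing_at I p G"

lemma opposed_at_product_le:
  assumes "opposed_at I p F G" "x \<in> extensional I"
  shows "(F (x(p := s)) - F (x(p := t))) * (G (x(p := s)) - G (x(p := t))) \<le> 0"
proof -
  have "s \<le> t \<or> t \<le> s" by auto
  then show ?thesis
    using assms unfolding opposed_at_def increasing_at_def mono_def
    by (smt (verit) mult_nonneg_nonpos mult_nonpos_nonneg mult_eq_0_iff)
qed

lemma increasing_at_average:
  fixes \<mu> :: "real measure"
  assumes F: "increasing_at (insert q I) p F" and "p \<in> I" and "q \<notin> I"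
    and int: "\<And>x. x \<in> extensional I \<Longrightarrow> integrable \<mu> (\<lambda>y. F (x(q := y)))"
  shows "increasing_at I p (\<lambda>x. \<integral>y. F (x(q := y)) \<partial>\<mu>)"
  unfolding increasing_at_def
proof (intro ballI monoI)
  fix x :: "'a \<Rightarrow> real" and s t :: real
  assume x: "x \<in> extensional I" and "s \<le> t"
  have upd: "x(p := a) \<in> extensional I" for a
    using x \<open>p \<in> I\<close> by (auto simp: extensional_def)
  have "p \<noteq> q"
    using \<open>p \<in> I\<close> \<open>q \<notin> I\<close> by auto
  show "(\<integral>y. F ((x(p := s))(q := y)) \<partial>\<mu>) \<le> (\<integral>y. F ((x(p := t))(q := y)) \<partial>\<mu>)"
  proof (rule integral_mono)
    fix y
    have "x(q := y) \<in> extensional (insert q I)"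
      using x by (auto simp: extensional_def)
    then have "F ((x(q := y))(p := s)) \<le> F ((x(q := y))(p := t))"
      using F \<open>s \<le> t\<close> unfolding increasing_at_def mono_def by blast
    then show "F ((x(p := s))(q := y)) \<le> F ((x(p := t))(q := y))"
      using \<open>p \<noteq> q\<close> by (simp add: fun_upd_twist)
  qed (use int[OF upd] in auto)
qed

text \<open>
  A Harris-type inequality, by induction on the coordinates. The induction hypothesis is applied to
  the averages of \<open>F\<close> and \<open>G\<close> over the new coordinate \<open>q\<close>, which are again bounded, measurable
  and opposed.
\<close>

theorem product_integral_le_if_opposed:
  fixes \<nu> :: "'i \<Rightarrow> real measure"
  assumes prob: "\<And>i. prob_space (\<nu> i)" and borel: "\<And>i. sets (\<nu> i) = sets borel"
    and "finite I"
    and "F \<in> borel_measurable (PiM I \<nu>)" and "G \<in> borel_measurable (PiM I \<nu>)"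
    and "\<And>x. x \<in> extensional I \<Longrightarrow> \<bar>F x\<bar> \<le> B" and "\<And>x. x \<in> extensional I \<Longrightarrow> \<bar>G x\<bar> \<le> B"
    and "\<And>p. p \<in> I \<Longrightarrow> opposed_at I p F G"
  shows "(\<integral>x. F x * G x \<partial>PiM I \<nu>) \<le> (\<integral>x. F x \<partial>PiM I \<nu>) * (\<integral>x. G x \<partial>PiM I \<nu>)"
  using assms(3-)
proof (induction I arbitrary: F G rule: finite_induct)
  case empty
  show ?case
    by (simp add: PiM_empty lebesgue_integral_count_space_finite)
next
  case (insert q I)
  interpret Q: prob_space "\<nu> q" by (rule prob)
  interpret product_prob_space \<nu>
    by (rule product_prob_spaceI) (rule prob)
  interpret PI: prob_space "PiM I \<nu>" by (rule prob_space_PiM) (rule prob)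
  interpret PQ: prob_space "PiM (insert q I) \<nu>" by (rule prob_space_PiM) (rule prob)
  have spc: "space (\<nu> i) = UNIV" for i
    using sets_eq_imp_space_eq[OF borel] by simp
  have spP: "space (PiM J \<nu>) = extensional J" for J
    by (simp add: space_PiM spc PiE_UNIV_domain PiE_def)
  define av where "av H x = (\<integral>y. H (x(q := y)) \<partial>\<nu> q)" for H :: "('i \<Rightarrow> real) \<Rightarrow> real" and x
  have upd: "x(q := y) \<in> extensional (insert q I)" if "x \<in> extensional I" for x :: "'i \<Rightarrow> real" and y
    using that by (auto simp: extensional_def)
  have pair: "(\<lambda>(x, y). H (x(q := y))) \<in> borel_measurable (PiM I \<nu> \<Otimes>\<^sub>M \<nu> q)"
    if "H \<in> borel_measurable (PiM (insert q I) \<nu>)" for H :: "('i \<Rightarrow> real) \<Rightarrow> real"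
    using measurable_compose[OF measurable_add_dim that] by (simp add: case_prod_beta')
  have av_meas: "av H \<in> borel_measurable (PiM I \<nu>)"
    if "H \<in> borel_measurable (PiM (insert q I) \<nu>)" for H
    using Q.borel_measurable_lebesgue_integral[OF pair[OF that]] by (simp add: av_def[abs_def])
  have slice_int: "integrable (\<nu> q) (\<lambda>y. H (x(q := y)))"
    if "H \<in> borel_measurable (PiM (insert q I) \<nu>)" "\<And>x. x \<in> extensional (insert q I) \<Longrightarrow> \<bar>H x\<bar> \<le> C"
      "x \<in> extensional I" for H :: "('i \<Rightarrow> real) \<Rightarrow> real" and C x
  proof (rule Q.integrable_bounded)
    show "(\<lambda>y. H (x(q := y))) \<in> borel_measurable (\<nu> q)"
      using measurable_Pair2[OF pair[OF that(1)], of x] that(3) by (simp add: spP)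
  qed (use that upd in auto)
  have av_bound: "\<bar>av H x\<bar> \<le> C"
    if "H \<in> borel_measurable (PiM (insert q I) \<nu>)" "\<And>x. x \<in> extensional (insert q I) \<Longrightarrow> \<bar>H x\<bar> \<le> C"
      "x \<in> extensional I" for H :: "('i \<Rightarrow> real) \<Rightarrow> real" and C x
  proof -
    have "\<bar>av H x\<bar> \<le> (\<integral>y. \<bar>H (x(q := y))\<bar> \<partial>\<nu> q)"
      unfolding av_def by (rule integral_abs_bound)
    also have "\<dots> \<le> (\<integral>y. C \<partial>\<nu> q)"
      by (rule integral_mono) (use slice_int[OF that] that(2) upd[OF that(3)] in auto)
    finally show ?thesis
      by (simp add: Q.prob_space)
  qed
  have fubini: "(\<integral>x. H x \<partial>PiM (insert q I) \<nu>) = (\<integral>x. av H x \<partial>PiM I \<nu>)"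
    if "H \<in> borel_measurable (PiM (insert q I) \<nu>)" "\<And>x. x \<in> extensional (insert q I) \<Longrightarrow> \<bar>H x\<bar> \<le> C"
    for H :: "('i \<Rightarrow> real) \<Rightarrow> real" and C
    unfolding av_def
    by (rule product_integral_insert[OF insert.hyps(1,2)]) (rule PQ.integrable_bounded, use that spP in auto)
  note F = insert.prems(1) and G = insert.prems(2)
  note Fb = insert.prems(3) and Gb = insert.prems(4)
  have FG: "(\<lambda>x. F x * G x) \<in> borel_measurable (PiM (insert q I) \<nu>)"
    using F G by simp
  have FGb: "\<bar>F x * G x\<bar> \<le> B * B" if "x \<in> extensional (insert q I)" for x
    unfolding abs_mult by (intro mult_mono Fb Gb that) (use Fb[OF that] in auto)
  have opp: "opposed_at I p (av F) (av G)" if "p \<in> I" for p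
  proof -
    have up: "increasing_at I p (av H)"
      if "increasing_at (insert q I) p H" "H \<in> borel_measurable (PiM (insert q I) \<nu>)"
        "\<And>x. x \<in> extensional (insert q I) \<Longrightarrow> \<bar>H x\<bar> \<le> B" for H
      unfolding av_def using that \<open>p \<in> I\<close> insert.hyps(2)
      by (intro increasing_at_average slice_int) auto
    have down: "decreasing_at I p (av H)"
      if "decreasing_at (insert q I) p H" "H \<in> borel_measurable (PiM (insert q I) \<nu>)"
        "\<And>x. x \<in> extensional (insert q I) \<Longrightarrow> \<bar>H x\<bar> \<le> B" for H
      using up[OF that(1)] that(2,3) by (simp add: av_def[abs_def])
    show ?thesis
      using insert.prems(5)[of p] that up[OF _ F Fb] up[OF _ G Gb] down[OF _ F Fb] down[OF _ G Gb]
      unfolding opposed_at_def by blast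
  qed
  \<comment> \<open>Fubini, then Chebyshev's inequality in coordinate \<open>q\<close>, then the induction hypothesis.\<close>
  have "(\<integral>x. F x * G x \<partial>PiM (insert q I) \<nu>) = (\<integral>x. av (\<lambda>x. F x * G x) x \<partial>PiM I \<nu>)"
    by (rule fubini[OF FG FGb])
  also have "\<dots> \<le> (\<integral>x. av F x * av G x \<partial>PiM I \<nu>)"
  proof (rule integral_mono)
    show "integrable (PiM I \<nu>) (av (\<lambda>x. F x * G x))"
      by (rule PI.integrable_bounded[OF av_meas[OF FG]]) (use av_bound[OF FG FGb] spP in auto)
    show "integrable (PiM I \<nu>) (\<lambda>x. av F x * av G x)"
    proof (rule PI.integrable_bounded[where B = "B * B"])
      fix x assume "x \<in> space (PiM I \<nu>)"
      then have "\<bar>av F x\<bar> \<le> B" "\<bar>av G x\<bar> \<le> B"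
        using av_bound[OF F Fb] av_bound[OF G Gb] spP by auto
      then show "\<bar>av F x * av G x\<bar> \<le> B * B"
        unfolding abs_mult by (intro mult_mono) auto
    qed (use av_meas[OF F] av_meas[OF G] in simp)
    fix x assume "x \<in> space (PiM I \<nu>)"
    then have x: "x \<in> extensional I" by (simp add: spP)
    have "(F (x(q := s)) - F (x(q := t))) * (G (x(q := s)) - G (x(q := t))) \<le> 0" for s t
      using opposed_at_product_le[OF insert.prems(5) upd[OF x, of s], of q s t]
      by (simp only: fun_upd_upd insertI1)
    then show "av (\<lambda>x. F x * G x) x \<le> av F x * av G x"
      unfolding av_def
      by (intro Q.chebyshev_oppositely_ordered slice_int[OF F Fb x] slice_int[OF G Gb x]
          slice_int[OF FG FGb x])
  qed
  also have "\<dots> \<le> (\<integral>x. av F x \<partial>PiM I \<nu>) * (\<integral>x. av G x \<partial>PiM I \<nu>)"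
    by (rule insert.IH) (use av_meas F G av_bound[OF F Fb] av_bound[OF G Gb] opp in auto)
  also have "\<dots> = (\<integral>x. F x \<partial>PiM (insert q I) \<nu>) * (\<integral>x. G x \<partial>PiM (insert q I) \<nu>)"
    using fubini[OF F Fb] fubini[OF G Gb] by simp
  finally show ?case .
qed


text \<open>
  The joint law of independent variables is the product of their laws, so the inequality on the
  product space is one between expectations.
\<close>

corollary (in prob_space) expectation_mult_le_if_opposed:
  fixes Y :: "'i \<Rightarrow> 'a \<Rightarrow> real"
  assumes indep: "indep_vars (\<lambda>_. borel) Y I" and "finite I"
    and F: "F \<in> borel_measurable (PiM I (\<lambda>_. borel))"
    and G: "G \<in> borel_measurable (PiM I (\<lambda>_. borel))"
    and bounded: "\<And>x. x \<in> extensional I \<Longrightarrow> \<bar>F x\<bar> \<le> B" "\<And>x. x \<in> extensional I \<Longrightarrow> \<bar>G x\<bar> \<le> B"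
    and opposed: "\<And>p. p \<in> I \<Longrightarrow> opposed_at I p F G"
  shows "expectation (\<lambda>\<omega>. F (\<lambda>i\<in>I. Y i \<omega>) * G (\<lambda>i\<in>I. Y i \<omega>))
    \<le> expectation (\<lambda>\<omega>. F (\<lambda>i\<in>I. Y i \<omega>)) * expectation (\<lambda>\<omega>. G (\<lambda>i\<in>I. Y i \<omega>))"
proof (cases "I = {}")
  case True
  then show ?thesis
    by (simp add: restrict_def prob_space)
next
  case False
  \<comment> \<open>The product inequality asks for a probability measure at every index; outside \<open>I\<close> the variable
    \<open>Y i\<close> may fail to be measurable, and the constant \<open>0\<close> takes its place.\<close>
  define Y' where "Y' i = (if i \<in> I then Y i else (\<lambda>_. 0))" for i
  define \<nu> where "\<nu> i = distr M borel (Y' i)" for i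
  have Y: "Y i \<in> borel_measurable M" if "i \<in> I" for i
    using indep that by (auto simp: indep_vars_def)
  then have Y': "Y' i \<in> borel_measurable M" for i
    by (auto simp: Y'_def)
  have sets_\<nu>: "sets (PiM I \<nu>) = sets (PiM I (\<lambda>_. borel))"
    by (rule sets_PiM_cong) (auto simp: \<nu>_def)
  have vec: "(\<lambda>\<omega>. \<lambda>i\<in>I. Y i \<omega>) \<in> measurable M (PiM I (\<lambda>_. borel))"
    by (rule measurable_restrict) (rule Y)
  have "distr M (PiM I (\<lambda>_. borel)) (\<lambda>\<omega>. \<lambda>i\<in>I. Y i \<omega>) = PiM I (\<lambda>i. distr M borel (Y i))"
    using indep_vars_iff_distr_eq_PiM'[OF False, where M' = "\<lambda>_. borel" and X = Y] Y indep by simp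
  also have "\<dots> = PiM I \<nu>"
    by (rule PiM_cong) (auto simp: \<nu>_def Y'_def)
  finally have law: "distr M (PiM I (\<lambda>_. borel)) (\<lambda>\<omega>. \<lambda>i\<in>I. Y i \<omega>) = PiM I \<nu>" .
  have push: "expectation (\<lambda>\<omega>. H (\<lambda>i\<in>I. Y i \<omega>)) = (\<integral>x. H x \<partial>PiM I \<nu>)"
    if "H \<in> borel_measurable (PiM I (\<lambda>_. borel))" for H :: "('i \<Rightarrow> real) \<Rightarrow> real"
    using integral_distr[OF vec that] by (simp add: law)
  have "(\<integral>x. F x * G x \<partial>PiM I \<nu>) \<le> (\<integral>x. F x \<partial>PiM I \<nu>) * (\<integral>x. G x \<partial>PiM I \<nu>)"
  proof (rule product_integral_le_if_opposed[where B = B])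
    show "prob_space (\<nu> i)" for i
      unfolding \<nu>_def by (rule prob_space_distr) (rule Y')
  qed (use assms sets_\<nu> in \<open>auto simp: \<nu>_def cong: measurable_cong_sets\<close>)
  then show ?thesis
    using push[OF F] push[OF G] push[OF borel_measurable_times[OF F G]] by simp
qed

section \<open>Scores as functions of the independent rewards\<close>

text \<open>
  A score as a function on the product space of the rewards with \<open>i < j\<close>, the independent ones;
  the rewards in the other direction are eliminated by the constant-sum relation.
\<close>

definition score_of_rewards ::
  "nat \<Rightarrow> (nat \<Rightarrow> nat \<Rightarrow> real) \<Rightarrow> nat \<Rightarrow> (nat \<times> nat \<Rightarrow> real) \<Rightarrow> real" where
  "score_of_rewards n r i x = (\<Sum>j\<in>{1..n} - {i}. if i < j then x (i, j) else r j i - x (j, i))"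

lemma score_eq_score_of_rewards:
  assumes "round_robin M n r X" and "i \<in> {1..n}" and "\<omega> \<in> space M"
  shows "score n X i \<omega> = score_of_rewards n r i (\<lambda>p\<in>pairs n. (case p of (i, j) \<Rightarrow> X i j) \<omega>)"
  unfolding score_def score_of_rewards_def
proof (rule sum.cong)
  fix j assume j: "j \<in> {1..n} - {i}"
  show "X i j \<omega> = (if i < j then (\<lambda>p\<in>pairs n. (case p of (i, j) \<Rightarrow> X i j) \<omega>) (i, j)
      else r j i - (\<lambda>p\<in>pairs n. (case p of (i, j) \<Rightarrow> X i j) \<omega>) (j, i))"
  proof (cases "i < j")
    case True
    then show ?thesis
      using assms(2) j by (auto simp: pairs_def)
  next
    case False
    then have "(j, i) \<in> pairs n"
      using assms(2) j by (auto simp: pairs_def)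
    moreover from this have "X i j \<omega> = r j i - X j i \<omega>"
      using assms(1,3) unfolding round_robin_def by blast
    ultimately show ?thesis
      using False by simp
  qed
qed simp

lemma finite_pairs: "finite (pairs n)"
  by (rule finite_subset[of _ "{1..n} \<times> {1..n}"]) (auto simp: pairs_def)

lemma score_of_rewards_measurable:
  assumes "i \<in> {1..n}"
  shows "score_of_rewards n r i \<in> borel_measurable (PiM (pairs n) (\<lambda>_. borel))"
  unfolding score_of_rewards_def[abs_def]
proof (rule borel_measurable_sum)
  fix j assume j: "j \<in> {1..n} - {i}"
  have comp: "(\<lambda>x. x p) \<in> borel_measurable (PiM (pairs n) (\<lambda>_. borel :: real measure))" if "p \<in> pairs n" for p
    using measurable_component_singleton[OF that, of "\<lambda>_. borel"] .
  show "(\<lambda>x. if i < j then x (i, j) else r j i - x (j, i)) \<in> borel_measurable (PiM (pairs n) (\<lambda>_. borel))"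
  proof (cases "i < j")
    case True
    then show ?thesis
      using comp[of "(i, j)"] assms j by (simp add: pairs_def)
  next
    case False
    then show ?thesis
      using comp[of "(j, i)"] assms j
      by (auto simp: pairs_def intro!: borel_measurable_diff borel_measurable_const)
  qed
qed

lemma score_of_rewards_fun_upd:
  assumes "(i, j) \<in> pairs n" and "k \<in> {1..n}"
  shows "score_of_rewards n r k (x((i, j) := t)) = score_of_rewards n r k x
    + (if k = i then t - x (i, j) else if k = j then x (i, j) - t else 0)"
proof -
  have ij: "i < j" "i \<noteq> j" "j \<noteq> i" "i \<in> {1..n}" "j \<in> {1..n}"
    using assms(1) by (auto simp: pairs_def)
  \<comment> \<open>In the sum for player \<open>k\<close>, only the match against the other member of the pair changes.\<close>
  have "score_of_rewards n r k (x((i, j) := t)) - score_of_rewards n r k x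
      = (\<Sum>l\<in>{1..n} - {k}. (if l = j then if k = i then t - x (i, j) else 0 else 0)
          + (if l = i then if k = j then x (i, j) - t else 0 else 0))"
    unfolding score_of_rewards_def sum_subtractf[symmetric]
    by (rule sum.cong) (use ij in auto)
  also have "\<dots> = (if k = i then t - x (i, j) else if k = j then x (i, j) - t else 0)"
    unfolding sum.distrib using ij by (auto simp: sum.delta)
  finally show ?thesis
    by simp
qed

text \<open>
  If \<open>j\<close> is not among the players in \<open>A\<close>, then the reward of match \<open>(i, j)\<close> acts on their scores
  only through \<open>S\<^sub>i\<close>, as a translation; if \<open>i\<close> is not in \<open>A\<close> either, it does not act at all.
  The next lemma is the mirror image for the score of \<open>j\<close>.
\<close>

lemma increasing_at_if_second_notin:
  assumes f: "increasing_in_coords A f" and A: "A \<subseteq> {1..n}" and ij: "(i, j) \<in> pairs n" and "j \<notin> A"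
  shows "increasing_at I (i, j) (\<lambda>x. f (\<lambda>k\<in>A. score_of_rewards n r k x))"
  unfolding increasing_at_def
proof (intro ballI)
  fix x :: "nat \<times> nat \<Rightarrow> real"
  define y where "y = (\<lambda>k\<in>A. score_of_rewards n r k x)"
  have y: "y \<in> extensional A"
    by (simp add: y_def)
  show "mono (\<lambda>t. f (\<lambda>k\<in>A. score_of_rewards n r k (x((i, j) := t))))"
  proof (cases "i \<in> A")
    case True
    have "(\<lambda>k\<in>A. score_of_rewards n r k (x((i, j) := t)))
        = y(i := t + (score_of_rewards n r i x - x (i, j)))" for t
      using True A \<open>j \<notin> A\<close> by (auto simp: y_def fun_eq_iff score_of_rewards_fun_upd[OF ij] subset_iff)
    moreover have "mono (\<lambda>t. f (y(i := t)))"
      using f y True by (simp add: increasing_in_coords_def)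
    ultimately show ?thesis
      by (simp add: mono_def)
  next
    case False
    have "(\<lambda>k\<in>A. score_of_rewards n r k (x((i, j) := t))) = y" for t
      using False A \<open>j \<notin> A\<close> by (auto simp: y_def fun_eq_iff score_of_rewards_fun_upd[OF ij] subset_iff)
    then show ?thesis
      by (simp add: mono_def)
  qed
qed

lemma decreasing_at_if_first_notin:
  assumes f: "increasing_in_coords A f" and A: "A \<subseteq> {1..n}" and ij: "(i, j) \<in> pairs n" and "i \<notin> A"
  shows "decreasing_at I (i, j) (\<lambda>x. f (\<lambda>k\<in>A. score_of_rewards n r k x))"
  unfolding increasing_at_def
proof (intro ballI)
  fix x :: "nat \<times> nat \<Rightarrow> real"
  define y where "y = (\<lambda>k\<in>A. score_of_rewards n r k x)"
  have y: "y \<in> extensional A"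
    by (simp add: y_def)
  show "mono (\<lambda>t. - f (\<lambda>k\<in>A. score_of_rewards n r k (x((i, j) := t))))"
  proof (cases "j \<in> A")
    case True
    have "(\<lambda>k\<in>A. score_of_rewards n r k (x((i, j) := t)))
        = y(j := (score_of_rewards n r j x + x (i, j)) - t)" for t
      using True A \<open>i \<notin> A\<close> by (auto simp: y_def fun_eq_iff score_of_rewards_fun_upd[OF ij] subset_iff)
    moreover have "mono (\<lambda>t. f (y(j := t)))"
      using f y True by (simp add: increasing_in_coords_def)
    ultimately show ?thesis
      by (simp add: mono_def)
  next
    case False
    have "(\<lambda>k\<in>A. score_of_rewards n r k (x((i, j) := t))) = y" for t
      using False A \<open>i \<notin> A\<close> by (auto simp: y_def fun_eq_iff score_of_rewards_fun_upd[OF ij] subset_iff)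
    then show ?thesis
      by (simp add: mono_def)
  qed
qed

text \<open>
  Each player of a match \<open>(i, j)\<close> is missing from at least one of the two disjoint sets. If both are
  missing from the same set, the function of that set is both increasing and decreasing in the
  reward; otherwise each set misses exactly one of them, and the functions are opposite.
\<close>

lemma opposed_at_disjoint_scores:
  assumes "increasing_in_coords A\<^sub>1 f\<^sub>1" and "increasing_in_coords A\<^sub>2 f\<^sub>2"
    and "A\<^sub>1 \<subseteq> {1..n}" and "A\<^sub>2 \<subseteq> {1..n}" and "A\<^sub>1 \<inter> A\<^sub>2 = {}" and "p \<in> pairs n"
  shows "opposed_at I p (\<lambda>x. f\<^sub>1 (\<lambda>k\<in>A\<^sub>1. score_of_rewards n r k x))
    (\<lambda>x. f\<^sub>2 (\<lambda>k\<in>A\<^sub>2. score_of_rewards n r k x))"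
proof -
  obtain i j where p: "p = (i, j)"
    by (cases p)
  have ij: "(i, j) \<in> pairs n"
    using assms(6) p by simp
  show ?thesis
    unfolding opposed_at_def p
    using increasing_at_if_second_notin[OF assms(1,3) ij] increasing_at_if_second_notin[OF assms(2,4) ij]
      decreasing_at_if_first_notin[OF assms(1,3) ij] decreasing_at_if_first_notin[OF assms(2,4) ij] assms(5)
    by blast
qed

section \<open>Negative association of the scores\<close>

theorem negatively_associated_scores:
  assumes rr: "round_robin M n r X"
  shows "negatively_associated M {1..n} (score n X)"
  unfolding negatively_associated_def
proof (intro allI impI, elim conjE)
  fix A\<^sub>1 A\<^sub>2 :: "nat set" and f\<^sub>1 f\<^sub>2 :: "(nat \<Rightarrow> real) \<Rightarrow> real"
  assume A: "A\<^sub>1 \<subseteq> {1..n}" "A\<^sub>2 \<subseteq> {1..n}" "A\<^sub>1 \<inter> A\<^sub>2 = {}"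
    and f\<^sub>1: "f\<^sub>1 \<in> borel_measurable (PiM A\<^sub>1 (\<lambda>_. borel))" "increasing_in_coords A\<^sub>1 f\<^sub>1"
    and f\<^sub>2: "f\<^sub>2 \<in> borel_measurable (PiM A\<^sub>2 (\<lambda>_. borel))" "increasing_in_coords A\<^sub>2 f\<^sub>2"
    and cov: "has_covariance M (\<lambda>\<omega>. f\<^sub>1 (\<lambda>i\<in>A\<^sub>1. score n X i \<omega>)) (\<lambda>\<omega>. f\<^sub>2 (\<lambda>j\<in>A\<^sub>2. score n X j \<omega>))"
  interpret prob_space M
    using rr by (simp add: round_robin_def)
  have indep: "indep_vars (\<lambda>_. borel) (\<lambda>(i, j). X i j) (pairs n)"
    using rr by (simp add: round_robin_def)
  let ?W = "\<lambda>\<omega>. \<lambda>p\<in>pairs n. (case p of (i, j) \<Rightarrow> X i j) \<omega>"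
  let ?T = "\<lambda>A x. \<lambda>i\<in>A. score_of_rewards n r i x"
  let ?c = "\<lambda>(k::nat) t. max (- real k) (min (real k) t) :: real"
  have scores: "(\<lambda>i\<in>A. score n X i \<omega>) = ?T A (?W \<omega>)" if "A \<subseteq> {1..n}" "\<omega> \<in> space M" for A \<omega>
    using score_eq_score_of_rewards[OF rr _ that(2)] that(1) by (auto simp: fun_eq_iff)
  have meas: "(\<lambda>x. ?c k (f (?T A x))) \<in> borel_measurable (PiM (pairs n) (\<lambda>_. borel))"
    if "A \<subseteq> {1..n}" "f \<in> borel_measurable (PiM A (\<lambda>_. borel))" for A k and f :: "(nat \<Rightarrow> real) \<Rightarrow> real"
  proof -
    have "?T A \<in> measurable (PiM (pairs n) (\<lambda>_. borel)) (PiM A (\<lambda>_. borel))"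
      by (rule measurable_restrict) (use that score_of_rewards_measurable in auto)
    then have "(\<lambda>x. f (?T A x)) \<in> borel_measurable (PiM (pairs n) (\<lambda>_. borel))"
      by (rule measurable_compose) (rule that)
    then show ?thesis
      by measurable
  qed
  have clip: "increasing_in_coords A (\<lambda>x. ?c k (f x))" if "increasing_in_coords A f" for A f k
  proof -
    have "?c k s \<le> ?c k t" if "s \<le> t" for s t
      using that by auto
    then show ?thesis
      using that unfolding increasing_in_coords_def mono_def by blast
  qed
  \<comment> \<open>The clipped functions are bounded and still increasing, so they are opposed in every match.\<close>
  have "expectation (\<lambda>\<omega>. ?c k (f\<^sub>1 (?T A\<^sub>1 (?W \<omega>))) * ?c k (f\<^sub>2 (?T A\<^sub>2 (?W \<omega>))))
      \<le> expectation (\<lambda>\<omega>. ?c k (f\<^sub>1 (?T A\<^sub>1 (?W \<omega>)))) * expectation (\<lambda>\<omega>. ?c k (f\<^sub>2 (?T A\<^sub>2 (?W \<omega>))))" for k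
    using opposed_at_disjoint_scores[OF clip[OF f\<^sub>1(2)] clip[OF f\<^sub>2(2)] A]
    by (intro expectation_mult_le_if_opposed[OF indep finite_pairs meas[OF A(1) f\<^sub>1(1)]
          meas[OF A(2) f\<^sub>2(1)], where B = "real k"]) auto
  then have trunc: "expectation (\<lambda>\<omega>. ?c k (f\<^sub>1 (\<lambda>i\<in>A\<^sub>1. score n X i \<omega>)) * ?c k (f\<^sub>2 (\<lambda>i\<in>A\<^sub>2. score n X i \<omega>)))
      \<le> expectation (\<lambda>\<omega>. ?c k (f\<^sub>1 (\<lambda>i\<in>A\<^sub>1. score n X i \<omega>))) * expectation (\<lambda>\<omega>. ?c k (f\<^sub>2 (\<lambda>i\<in>A\<^sub>2. score n X i \<omega>)))" for k
    by (simp add: scores[OF A(1)] scores[OF A(2)] cong: Bochner_Integration.integral_cong)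
  show "covariance M (\<lambda>\<omega>. f\<^sub>1 (\<lambda>i\<in>A\<^sub>1. score n X i \<omega>)) (\<lambda>\<omega>. f\<^sub>2 (\<lambda>j\<in>A\<^sub>2. score n X j \<omega>)) \<le> 0"
    using product_integral_le_by_truncation[OF _ _ _ trunc] cov covariance_eq[OF cov]
    by (simp add: has_covariance_def)
qed

section \<open>Orthant dependence\<close>

text \<open>
  Lower and upper orthants are treated together: \<open>U i\<close> stands for a half-line and \<open>c\<close> for the sign that
  makes its indicator increasing. The test functions are \<open>c\<close> times the indicator of the event for the
  players already treated and \<open>c\<close> times the indicator for one new player; as \<open>c * c = 1\<close>, their
  covariance is the difference between the probability of the joint event and the product of the two
  probabilities.
\<close>

lemma (in prob_space) negatively_associated_orthant_le:
  assumes NA: "negatively_associated M I S" and "finite I"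
    and S: "\<And>i. i \<in> I \<Longrightarrow> S i \<in> borel_measurable M"
    and U: "\<And>i. U i \<in> sets borel" and c: "c = 1 \<or> c = - 1"
    and mono: "\<And>i. mono (\<lambda>t::real. c * indicator (U i) t :: real)"
  shows "prob {\<omega>\<in>space M. \<forall>i\<in>I. S i \<omega> \<in> U i} \<le> (\<Prod>i\<in>I. prob {\<omega>\<in>space M. S i \<omega> \<in> U i})"
proof -
  have "prob {\<omega>\<in>space M. \<forall>i\<in>J. S i \<omega> \<in> U i} \<le> (\<Prod>i\<in>J. prob {\<omega>\<in>space M. S i \<omega> \<in> U i})"
    if "finite J" "J \<subseteq> I" for J
    using that
  proof (induction J rule: finite_induct)
    case empty
    show ?case
      by (simp add: prob_space)
  next
    case (insert k J)
    define E where "E K = {\<omega>\<in>space M. \<forall>i\<in>K. S i \<omega> \<in> U i}" for K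
    \<comment> \<open>The indicator of an orthant as a product, so that one factor carries all the dependence on one
      coordinate.\<close>
    define f where "f K x = c * (\<Prod>i\<in>K. indicator (U i) (x i))" for K and x :: "'b \<Rightarrow> real"
    have fin: "finite K" if "K \<subseteq> I" for K
      using that \<open>finite I\<close> by (rule finite_subset)
    have E: "E K \<in> events" if "K \<subseteq> I" for K
    proof -
      have "{\<omega>\<in>space M. S i \<omega> \<in> U i} \<in> events" if "i \<in> K" for i
        using measurable_sets[OF S U, of i i] that \<open>K \<subseteq> I\<close> by (auto simp: vimage_def Int_def conj_commute)
      then show ?thesis
        unfolding E_def using fin[OF that] by (intro sets.sets_Collect_finite_All) auto
    qed
    have f_scores: "f K (\<lambda>i\<in>K. S i \<omega>) = c * indicator (E K) \<omega>" if K: "K \<subseteq> I" and \<omega>: "\<omega> \<in> space M" for K \<omega>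
    proof -
      have "(\<Prod>i\<in>K. indicator (U i) (S i \<omega>)) = (indicator (E K) \<omega> :: real)"
      proof (cases "\<omega> \<in> E K")
        case True
        then show ?thesis
          by (simp add: E_def)
      next
        case False
        then obtain i where "i \<in> K" "S i \<omega> \<notin> U i"
          using \<omega> by (auto simp: E_def)
        with False show ?thesis
          using fin[OF K] by (simp add: prod_zero_iff) (metis indicator_simps(2))
      qed
      then show ?thesis
        by (simp add: f_def)
    qed
    have f_meas: "f K \<in> borel_measurable (PiM K (\<lambda>_. borel))" for K
      unfolding f_def[abs_def]
      by (intro borel_measurable_times borel_measurable_const borel_measurable_prod
          measurable_compose[OF measurable_component_singleton borel_measurable_indicator] U)
    have f_inc: "increasing_in_coords K (f K)" if "K \<subseteq> I" for K
      unfolding increasing_in_coords_def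
    proof (intro ballI monoI)
      fix x :: "'b \<Rightarrow> real" and i and s t :: real
      assume "i \<in> K" "s \<le> t"
      have split: "f K (x(i := u)) = (c * indicator (U i) u) * (\<Prod>j\<in>K - {i}. indicator (U j) (x j))" for u
        unfolding f_def prod.remove[OF fin[OF that] \<open>i \<in> K\<close>] by (auto intro!: prod.cong)
      show "f K (x(i := s)) \<le> f K (x(i := t))"
        unfolding split using mono[of i] \<open>s \<le> t\<close>
        by (intro mult_right_mono prod_nonneg) (auto simp: mono_def)
    qed
    have k: "{k} \<subseteq> I" and J: "J \<subseteq> I"
      using insert.prems by auto
    have Ek: "E J \<inter> E {k} = E (insert k J)"
      by (auto simp: E_def)
    have int1: "integrable M (\<lambda>\<omega>. f K (\<lambda>i\<in>K. S i \<omega>))"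
      and exp1: "expectation (\<lambda>\<omega>. f K (\<lambda>i\<in>K. S i \<omega>)) = c * prob (E K)" if "K \<subseteq> I" for K
    proof -
      have "integrable M (\<lambda>\<omega>. c * indicator (E K) \<omega>)"
        using E[OF that] by (simp add: integrable_indicator_iff emeasure_eq_measure)
      then show "integrable M (\<lambda>\<omega>. f K (\<lambda>i\<in>K. S i \<omega>))"
        using f_scores[OF that] by (simp cong: Bochner_Integration.integrable_cong)
      show "expectation (\<lambda>\<omega>. f K (\<lambda>i\<in>K. S i \<omega>)) = c * prob (E K)"
        using f_scores[OF that] E[OF that] by (simp cong: Bochner_Integration.integral_cong)
    qed
    have prod_eq: "f J (\<lambda>i\<in>J. S i \<omega>) * f {k} (\<lambda>i\<in>{k}. S i \<omega>) = indicator (E (insert k J)) \<omega>"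
      if "\<omega> \<in> space M" for \<omega>
      unfolding f_scores[OF J that] f_scores[OF k that] Ek[symmetric] using c
      by (auto simp: indicator_def)
    have int2: "integrable M (\<lambda>\<omega>. f J (\<lambda>i\<in>J. S i \<omega>) * f {k} (\<lambda>i\<in>{k}. S i \<omega>))"
      and exp2: "expectation (\<lambda>\<omega>. f J (\<lambda>i\<in>J. S i \<omega>) * f {k} (\<lambda>i\<in>{k}. S i \<omega>)) = prob (E (insert k J))"
      using E[OF insert.prems]
      by (simp_all add: prod_eq integrable_indicator_iff emeasure_eq_measure
          cong: Bochner_Integration.integrable_cong Bochner_Integration.integral_cong)
    have cov: "has_covariance M (\<lambda>\<omega>. f J (\<lambda>i\<in>J. S i \<omega>)) (\<lambda>\<omega>. f {k} (\<lambda>i\<in>{k}. S i \<omega>))"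
      using int1[OF J] int1[OF k] int2 by (simp add: has_covariance_def)
    have "J \<inter> {k} = {}"
      using insert.hyps by auto
    then have "covariance M (\<lambda>\<omega>. f J (\<lambda>i\<in>J. S i \<omega>)) (\<lambda>\<omega>. f {k} (\<lambda>i\<in>{k}. S i \<omega>)) \<le> 0"
      using NA J k f_meas f_inc[OF J] f_inc[OF k] cov unfolding negatively_associated_def by blast
    then have "prob (E (insert k J)) \<le> prob (E J) * prob (E {k})"
      using c unfolding covariance_eq[OF cov] exp1[OF J] exp1[OF k] exp2 by auto
    also have "\<dots> \<le> (\<Prod>i\<in>J. prob {\<omega>\<in>space M. S i \<omega> \<in> U i}) * prob (E {k})"
      using insert.IH[OF J] by (intro mult_right_mono) (auto simp: E_def)
    finally show ?case
      using insert.hyps by (simp add: E_def mult.commute)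
  qed
  from this[OF \<open>finite I\<close> subset_refl] show ?thesis .
qed

theorem NOD_if_negatively_associated:
  assumes "prob_space M" and NA: "negatively_associated M I S" and "finite I"
    and S: "\<And>i. i \<in> I \<Longrightarrow> S i \<in> borel_measurable M"
  shows "NOD M I S"
proof -
  interpret prob_space M by fact
  have "prob {\<omega>\<in>space M. \<forall>i\<in>I. S i \<omega> \<in> {..s i}} \<le> (\<Prod>i\<in>I. prob {\<omega>\<in>space M. S i \<omega> \<in> {..s i}})"
    for s :: "'b \<Rightarrow> real"
    by (rule negatively_associated_orthant_le[where c = "- 1"])
      (use assms in \<open>auto simp: mono_def indicator_def\<close>)
  moreover have "prob {\<omega>\<in>space M. \<forall>i\<in>I. S i \<omega> \<in> {s i<..}} \<le> (\<Prod>i\<in>I. prob {\<omega>\<in>space M. S i \<omega> \<in> {s i<..}})"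
    for s :: "'b \<Rightarrow> real"
    by (rule negatively_associated_orthant_le[where c = 1])
      (use assms in \<open>auto simp: mono_def indicator_def\<close>)
  ultimately show ?thesis
    by (simp add: NOD_def NLOD_def NUOD_def)
qed

lemma score_measurable:
  assumes rr: "round_robin M n r X" and i: "i \<in> {1..n}"
  shows "score n X i \<in> borel_measurable M"
proof -
  interpret prob_space M
    using rr by (simp add: round_robin_def)
  have "(case p of (i, j) \<Rightarrow> X i j) \<in> borel_measurable M" if "p \<in> pairs n" for p
    using rr that by (auto simp: round_robin_def indep_vars_def)
  then have "(\<lambda>\<omega>. \<lambda>p\<in>pairs n. (case p of (i, j) \<Rightarrow> X i j) \<omega>) \<in> measurable M (PiM (pairs n) (\<lambda>_. borel))"
    by (intro measurable_restrict)
  from measurable_compose[OF this score_of_rewards_measurable[OF i]] show ?thesis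
    by (subst measurable_cong[OF score_eq_score_of_rewards[OF rr i]])
qed

theorem corollary2p1:
  fixes M :: "'a measure" and n :: nat
    and r p :: "nat \<Rightarrow> nat \<Rightarrow> real"
    and F :: "nat \<Rightarrow> nat \<Rightarrow> real \<Rightarrow> real"
    and X :: "nat \<Rightarrow> nat \<Rightarrow> 'a \<Rightarrow> real"
  assumes "constant_sum_model M n r F X \<or> integer_model M n r F X \<or>
    repeated_games_model M n r p X \<or> simple_model M n r p X \<or> chess_model M n r X"
  shows "negatively_associated M {1..n} (score n X) \<and>
    NLOD M {1..n} (score n X) \<and> NUOD M {1..n} (score n X) \<and> NOD M {1..n} (score n X)"
proof -
  have rr: "round_robin M n r X"
    using assms unfolding constant_sum_model_def integer_model_def repeated_games_model_def
      simple_model_def chess_model_def by blast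
  then have "prob_space M"
    by (simp add: round_robin_def)
  have NA: "negatively_associated M {1..n} (score n X)"
    using rr by (rule negatively_associated_scores)
  have "NOD M {1..n} (score n X)"
    using \<open>prob_space M\<close> NA finite_atLeastAtMost score_measurable[OF rr] by (rule NOD_if_negatively_associated)
  with NA show ?thesis
    by (simp add: NOD_def)
qed

end
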